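(* Let $(N,(A_i)_{i\in N},(u_i)_{i\in N})$ be a finite strategic game with player set $N=\{1,\dots,n\}$ and noncooperative payoff region $S_{\mathrm{nc}}\subset\mathbb{R}^n$. Then every supporting hyperplane to $S_{\mathrm{nc}}$ contains at least one extreme point of $S_{\mathrm{nc}}$.
   Context: A finite strategic game $(N,(A_i)_{i\in N},(u_i)_{i\in N})$ consists of a player set $N=\{1,\dots,n\}$, for each $i\in N$ a nonempty finite set $A_i$ of pure strategies, and payoff functions $u_i\colon\prod_{j\in N}A_j\to\mathbb{R}$; put $u=(u_1,\dots,u_n)\colon\prod_{j\in N}A_j\to\mathbb{R}^n$. For a nonempty finite set $X$, $\Delta(X)$ is the set of probability distributions on $X$. For a mixed-strategy profile $\sigma=(\sigma_1,\dots,\sigma_n)\in\prod_{i\in N}\Delta(A_i)$ set $u(\sigma)=\sum_{a\in\prod_{i\in N}A_i}\big(\prod_{i\in N}\sigma_i(a_i)\big)u(a)$. The noncooperative payoff region is $S_{\mathrm{nc}}=u(\prod_{i\in N}\Delta(A_i))$. Extreme points of a (not necessarily convex) nonempty set $S\subseteq\mathbb{R}^n$: a point $x\in S$ is an extreme point of $S$ if, whenever $y,z\in S$ satisfy $x\in\{\theta y+(1-\theta)z\mid\theta\in(0,1)\}\subset S$, then $x=y=z$. (So only segments contained in $S$ are considered.) A hyperplane in $\mathbb{R}^n$ is a set $H=\{x\in\mathbb{R}^n\mid c\cdot x=\alpha\}$ with $c\in\mathbb{R}^n\setminus\{0\}$, $\alpha\in\mathbb{R}$; the closed half-spaces it determines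 are $\{x\mid c\cdot x\le\alpha\}$ and $\{x\mid c\cdot x\ge\alpha\}$. For a nonempty closed set $S\subseteq\mathbb{R}^n$, a hyperplane $H$ is a supporting hyperplane to $S$ if $S\cap H\ne\varnothing$ and $S$ is contained in one of the two closed half-spaces determined by $H$. *)

theory Defs
  imports "HOL-Analysis.Analysis" "HOL-Probability.Probability_Mass_Function"
begin

text \<open>
  The players are the elements of a finite type \<open>'n\<close>, so that payoff vectors live in \<open>real ^ 'n\<close>.
  The pure strategies of player \<open>i\<close> form a set \<open>A i\<close>, and all these sets are taken inside one type
  \<open>'a\<close>; this is no restriction, since \<open>'a\<close> can be a disjoint union. Values of \<open>u\<close> outside
  the product of the sets \<open>A i\<close> are never used.
\<close>

definition finite_strategic_game ::
  "('n::finite \<Rightarrow> 'a set) \<Rightarrow> ('n \<Rightarrow> ('n \<Rightarrow> 'a) \<Rightarrow> real) \<Rightarrow> bool" where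
  "finite_strategic_game A u \<longleftrightarrow> (\<forall>i. finite (A i) \<and> A i \<noteq> {})"

definition distributions_on :: "'a set \<Rightarrow> 'a pmf set" where
  "distributions_on X = {p. set_pmf p \<subseteq> X}"

definition payoff_vector ::
  "('n::finite \<Rightarrow> ('n \<Rightarrow> 'a) \<Rightarrow> real) \<Rightarrow> ('n \<Rightarrow> 'a) \<Rightarrow> real ^ 'n" where
  "payoff_vector u a = (\<chi> i. u i a)"

definition mixed_payoff ::
  "('n::finite \<Rightarrow> 'a set) \<Rightarrow> ('n \<Rightarrow> ('n \<Rightarrow> 'a) \<Rightarrow> real) \<Rightarrow> ('n \<Rightarrow> 'a pmf) \<Rightarrow> real ^ 'n" where
  "mixed_payoff A u \<sigma> =
     (\<Sum>a \<in> Pi\<^sub>E UNIV A. (\<Prod>i\<in>UNIV. pmf (\<sigma> i) (a i)) *\<^sub>R payoff_vector u a)"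

definition noncooperative_payoff_region ::
  "('n::finite \<Rightarrow> 'a set) \<Rightarrow> ('n \<Rightarrow> ('n \<Rightarrow> 'a) \<Rightarrow> real) \<Rightarrow> (real ^ 'n) set" where
  "noncooperative_payoff_region A u =
     mixed_payoff A u ` (Pi\<^sub>E UNIV (\<lambda>i. distributions_on (A i)))"

text \<open>
  Unlike the library's \<open>extreme_point_of\<close>, only segments contained in \<open>S\<close> are considered; the two
  notions differ for nonconvex \<open>S\<close>. The segment is written out because \<open>open_segment y y\<close> is
  empty, whereas here it is the singleton of \<open>y\<close>.
\<close>

definition segment_extreme_point :: "'v::real_vector \<Rightarrow> 'v set \<Rightarrow> bool" where
  "segment_extreme_point x S \<longleftrightarrow> x \<in> S \<and>
     (\<forall>y\<in>S. \<forall>z\<in>S.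
        x \<in> {\<theta> *\<^sub>R y + (1 - \<theta>) *\<^sub>R z | \<theta>. \<theta> \<in> {0<..<1::real}} \<and>
        {\<theta> *\<^sub>R y + (1 - \<theta>) *\<^sub>R z | \<theta>. \<theta> \<in> {0<..<1::real}} \<subseteq> S
        \<longrightarrow> x = y \<and> y = z)"

definition supporting_hyperplane :: "'v::real_inner set \<Rightarrow> 'v set \<Rightarrow> bool" where
  "supporting_hyperplane H S \<longleftrightarrow>
     (\<exists>c \<alpha>. c \<noteq> 0 \<and> H = {x. c \<bullet> x = \<alpha>} \<and> S \<inter> H \<noteq> {} \<and>
        (S \<subseteq> {x. c \<bullet> x \<le> \<alpha>} \<or> S \<subseteq> {x. c \<bullet> x \<ge> \<alpha>}))"

end

theory Submission
  imports Defs
begin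

text \<open>
  Only two features of the payoff region \<open>S\<close> matter: it contains the finite set \<open>P\<close> of pure payoff vectors,
  and it is contained in the convex hull \<open>C\<close> of \<open>P\<close>. A hyperplane supporting \<open>S\<close> therefore supports
  \<open>C\<close>, so it cuts out a nonempty compact face of \<open>C\<close>. An extreme point of that face is an
  extreme point of \<open>C\<close>, hence lies in \<open>P\<close> and so in \<open>S\<close>; since \<open>S\<close> is a subset of \<open>C\<close>, it is
  extreme in \<open>S\<close> as well.
\<close>

text \<open>Passing from \<open>C\<close> to the subset \<open>S\<close> only removes segments that
  could have \<open>x\<close> in their interior, so extremality is inherited.\<close>

lemma segment_extreme_pointI:
  assumes "x extreme_point_of C" "x \<in> S" "S \<subseteq> C"
  shows "segment_extreme_point x S"
  unfolding segment_extreme_point_def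
proof (intro conjI assms(2) ballI impI)
  fix y z
  assume yz: "y \<in> S" "z \<in> S"
    and seg: "x \<in> {\<theta> *\<^sub>R y + (1 - \<theta>) *\<^sub>R z | \<theta>. \<theta> \<in> {0<..<1::real}} \<and>
        {\<theta> *\<^sub>R y + (1 - \<theta>) *\<^sub>R z | \<theta>. \<theta> \<in> {0<..<1::real}} \<subseteq> S"
  then obtain t where t: "0 < t" "t < 1" "x = t *\<^sub>R y + (1 - t) *\<^sub>R z" by auto
  have "x \<notin> open_segment z y"
    using assms yz by (auto simp: extreme_point_of_def)
  \<comment> \<open>\<open>open_segment\<close> is empty for equal endpoints, so the convex
    combination in \<open>t\<close> contradicts extremality unless \<open>z = y\<close>.\<close>
  then have "z = y"
    using t by (auto simp: in_segment add.commute)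
  with t show "x = y" "y = z"
    by (auto simp: scaleR_left_distrib[symmetric])
qed

text \<open>Negating both \<open>c\<close> and \<open>\<alpha>\<close> keeps the hyperplane and
  swaps its half-spaces, so only one side needs treatment.\<close>

lemma supporting_hyperplane_le:
  assumes "supporting_hyperplane H S"
  obtains c \<alpha> where "H = {x. c \<bullet> x = \<alpha>}" "S \<inter> H \<noteq> {}" "\<And>x. x \<in> S \<Longrightarrow> c \<bullet> x \<le> \<alpha>"
proof -
  from assms obtain c \<alpha> where H: "H = {x. c \<bullet> x = \<alpha>}" "S \<inter> H \<noteq> {}"
    and "S \<subseteq> {x. c \<bullet> x \<le> \<alpha>} \<or> S \<subseteq> {x. c \<bullet> x \<ge> \<alpha>}"
    by (auto simp: supporting_hyperplane_def)
  then consider "\<forall>x\<in>S. c \<bullet> x \<le> \<alpha>" | "\<forall>x\<in>S. - c \<bullet> x \<le> - \<alpha>" by auto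
  then show thesis
  proof cases
    case 1
    with H show thesis by (intro that[of c \<alpha>]) auto
  next
    case 2
    with H show thesis by (intro that[of "- c" "- \<alpha>"]) auto
  qed
qed

lemma supporting_hyperplane_has_segment_extreme_point:
  fixes S P :: "'v::euclidean_space set"
  assumes "compact P" "P \<subseteq> S" "S \<subseteq> convex hull P" "supporting_hyperplane H S"
  shows "\<exists>x\<in>H. segment_extreme_point x S"
proof -
  obtain c \<alpha> where H: "H = {x. c \<bullet> x = \<alpha>}" "S \<inter> H \<noteq> {}" and le: "\<And>x. x \<in> S \<Longrightarrow> c \<bullet> x \<le> \<alpha>"
    using supporting_hyperplane_le[OF assms(4)] by metis
  define F where "F = (convex hull P) \<inter> {x. c \<bullet> x = \<alpha>}"
  \<comment> \<open>The bound holds on \<open>P\<close> because \<open>P\<close> lies in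
    \<open>S\<close>; it extends to the hull because a half-space is convex.\<close>
  have "convex hull P \<subseteq> {x. c \<bullet> x \<le> \<alpha>}"
    using assms(2) le by (intro hull_minimal convex_halfspace_le) auto
  then have face: "F face_of convex hull P"
    unfolding F_def by (intro face_of_Int_supporting_hyperplane_le convex_convex_hull) auto
  have "compact F"
    unfolding F_def by (intro compact_Int_closed compact_convex_hull assms(1) closed_hyperplane)
  moreover have "convex F"
    using face by (rule face_of_imp_convex)
  moreover have "F \<noteq> {}"
    using H assms(3) by (auto simp: F_def)
  ultimately obtain x where x: "x extreme_point_of F"
    using extreme_point_exists_convex by blast
  then have ext: "x extreme_point_of convex hull P" and "x \<in> F"
    using extreme_point_of_face[OF face] by auto
  from ext have "x \<in> P"
    by (rule extreme_point_of_convex_hull)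
  with ext assms(2,3) have "segment_extreme_point x S"
    by (intro segment_extreme_pointI[of x "convex hull P"]) auto
  with \<open>x \<in> F\<close> H show ?thesis
    by (auto simp: F_def)
qed

text \<open>Point masses give weight 1 to the profile \<open>a\<close> and 0 to every other profile,
  so the sum collapses to one term.\<close>

lemma mixed_payoff_return_pmf:
  assumes "\<And>i. finite (A i)" "a \<in> Pi\<^sub>E UNIV A"
  shows "mixed_payoff A u (\<lambda>i. return_pmf (a i)) = payoff_vector u a"
proof -
  have "(\<Prod>i\<in>UNIV. pmf (return_pmf (a i)) (b i)) = of_bool (b = a)" for b :: "'a \<Rightarrow> 'b"
  proof (cases "b = a")
    case False
    then obtain i where "b i \<noteq> a i" by auto
    then have "pmf (return_pmf (a i)) (b i) = 0" by (simp add: indicator_def)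
    with False show ?thesis by (auto intro!: prod_zero simp del: pmf_return)
  qed simp
  then have "mixed_payoff A u (\<lambda>i. return_pmf (a i)) =
      (\<Sum>b\<in>Pi\<^sub>E UNIV A. if b = a then payoff_vector u b else 0)"
    unfolding mixed_payoff_def by (intro sum.cong) auto
  also have "\<dots> = payoff_vector u a"
    using assms by (simp add: finite_PiE)
  finally show ?thesis .
qed

text \<open>The product weights are nonnegative and sum to 1, so a mixed payoff is a convex
  combination of pure ones.\<close>

lemma mixed_payoff_in_convex_hull:
  assumes fin: "\<And>i. finite (A i)" and \<sigma>: "\<And>i. \<sigma> i \<in> distributions_on (A i)"
  shows "mixed_payoff A u \<sigma> \<in> convex hull (payoff_vector u ` Pi\<^sub>E UNIV A)"
  unfolding mixed_payoff_def
proof (rule convex_sum)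
  show "finite (Pi\<^sub>E UNIV A)"
    using fin by (intro finite_PiE) auto
  \<comment> \<open>By distributivity the total weight factors over the players; each factor is the
    full mass of \<open>\<sigma> i\<close>, whose support lies in \<open>A i\<close>.\<close>
  have "(\<Sum>a\<in>Pi\<^sub>E UNIV A. \<Prod>i\<in>UNIV. pmf (\<sigma> i) (a i)) = (\<Prod>i\<in>UNIV. \<Sum>x\<in>A i. pmf (\<sigma> i) x)"
    using fin by (intro prod_sum_PiE[symmetric]) auto
  also have "\<dots> = 1"
    using fin \<sigma> by (intro prod.neutral ballI sum_pmf_eq_1) (auto simp: distributions_on_def)
  finally show "(\<Sum>a\<in>Pi\<^sub>E UNIV A. \<Prod>i\<in>UNIV. pmf (\<sigma> i) (a i)) = 1" .
qed (auto intro: prod_nonneg hull_inc)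

theorem corollary3p9:
  fixes A :: "'n::finite \<Rightarrow> 'a set"
    and u :: "'n \<Rightarrow> ('n \<Rightarrow> 'a) \<Rightarrow> real"
    and H :: "(real ^ 'n) set"
  assumes "finite_strategic_game A u"
    and "supporting_hyperplane H (noncooperative_payoff_region A u)"
  shows "\<exists>x\<in>H. segment_extreme_point x (noncooperative_payoff_region A u)"
proof (rule supporting_hyperplane_has_segment_extreme_point[OF _ _ _ assms(2)])
  have fin: "\<And>i. finite (A i)"
    using assms(1) by (simp add: finite_strategic_game_def)
  show "compact (payoff_vector u ` Pi\<^sub>E UNIV A)"
    using fin by (intro finite_imp_compact finite_imageI finite_PiE) auto
  show "payoff_vector u ` Pi\<^sub>E UNIV A \<subseteq> noncooperative_payoff_region A u"
  proof (rule image_subsetI)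
    fix a assume a: "a \<in> Pi\<^sub>E UNIV A"
    \<comment> \<open>Playing \<open>a\<close> with certainty is an admissible mixed
      profile.\<close>
    then have "(\<lambda>i. return_pmf (a i)) \<in> Pi\<^sub>E UNIV (\<lambda>i. distributions_on (A i))"
      by (auto simp: distributions_on_def)
    then show "payoff_vector u a \<in> noncooperative_payoff_region A u"
      unfolding noncooperative_payoff_region_def mixed_payoff_return_pmf[OF fin a, symmetric]
      by (rule imageI)
  qed
  show "noncooperative_payoff_region A u \<subseteq> convex hull (payoff_vector u ` Pi\<^sub>E UNIV A)"
    unfolding noncooperative_payoff_region_def
    using fin by (auto intro!: mixed_payoff_in_convex_hull)
qed

end
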